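(* Let $M$ be a matroid and let $(X,Y,Z)$ be a partition of its ground set $E$, where $Y$ may be empty. Suppose $(X,Y\cup Z)$ and $(X\cup Y,Z)$ are exact $3$-separations of $M$. Assume there is an $X$-strand $X_0$ and a $(Y\cup Z)$-strand $Y_0$ (with respect to the separation $(X,Y\cup Z)$) such that $\sqcap(X_0,Y_0)=1$ and $M$ has an extension by an element $p$ in which $X_0\cup p$ and $Y_0\cup p$ are circuits. Assume there is an $(X\cup Y)$-strand $Y_1$ and a $Z$-strand $Z_1$ (with respect to the separation $(X\cup Y,Z)$) such that $\sqcap(Y_1,Z_1)=1$ and $M$ has an extension by an element $q$ in which $Y_1\cup q$ and $Z_1\cup q$ are circuits. Then $M$ has a unique extension by the two elements $p$ and $q$ in which $X_0\cup p$, $Y_0\cup p$, $Y_1\cup q$ and $Z_1\cup q$ are all circuits.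
   Context: For subsets $U,V$ of the ground set of a matroid with rank function $r$, $\sqcap(U,V)=r(U)+r(V)-r(U\cup V)$. A partition $(A,B)$ of the ground set is an exact $3$-separation if $|A|,|B|\ge 3$ and $r(A)+r(B)-r(M)=2$. For such a separation, an $A$-strand is a minimal subset $A'\subseteq A$ with $\sqcap(A',B)=1$, and a $B$-strand is a minimal subset $B'\subseteq B$ with $\sqcap(B',A)=1$. An extension of $M$ by new elements $P$ is a matroid $M'$ on $E\cup P$ with $M'\backslash P=M$. *)

theory Defs imports Main begin

text \<open>
  A matroid is a finite ground set \<open>E\<close> together with its independence predicate. As independent
  sets are required to be subsets of \<open>E\<close>, two matroids on \<open>E\<close> are equal as matroids iff their
  independence predicates are equal as functions.
\<close>

locale matroid =
  fixes E :: "'a set" and indep :: "'a set \<Rightarrow> bool"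
  assumes finite_ground: "finite E"
    and indep_subset_ground: "indep I \<Longrightarrow> I \<subseteq> E"
    and indep_empty: "indep {}"
    and indep_mono: "indep I \<Longrightarrow> J \<subseteq> I \<Longrightarrow> indep J"
    and indep_augment: "indep I \<Longrightarrow> indep J \<Longrightarrow> card I < card J \<Longrightarrow> \<exists>x\<in>J - I. indep (insert x I)"

definition rank :: "('a set \<Rightarrow> bool) \<Rightarrow> 'a set \<Rightarrow> nat" where
  "rank indep U = Max (card ` {I. I \<subseteq> U \<and> indep I})"

definition circuit :: "'a set \<Rightarrow> ('a set \<Rightarrow> bool) \<Rightarrow> 'a set \<Rightarrow> bool" where
  "circuit E indep C \<longleftrightarrow> C \<subseteq> E \<and> \<not> indep C \<and> (\<forall>D. D \<subset> C \<longrightarrow> indep D)"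

definition local_conn :: "('a set \<Rightarrow> bool) \<Rightarrow> 'a set \<Rightarrow> 'a set \<Rightarrow> int" where
  "local_conn indep U V = int (rank indep U) + int (rank indep V) - int (rank indep (U \<union> V))"

definition exact_3_separation :: "'a set \<Rightarrow> ('a set \<Rightarrow> bool) \<Rightarrow> 'a set \<Rightarrow> 'a set \<Rightarrow> bool" where
  "exact_3_separation E indep A B \<longleftrightarrow>
     A \<inter> B = {} \<and> A \<union> B = E \<and> card A \<ge> 3 \<and> card B \<ge> 3 \<and>
     int (rank indep A) + int (rank indep B) - int (rank indep E) = 2"

text \<open>
  \<open>strand indep A B S\<close>: \<open>S\<close> is an \<open>A\<close>-strand of the separation \<open>(A, B)\<close>. The \<open>B\<close>-strands of
  \<open>(A, B)\<close> are obtained by exchanging \<open>A\<close> and \<open>B\<close>.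
\<close>

definition strand :: "('a set \<Rightarrow> bool) \<Rightarrow> 'a set \<Rightarrow> 'a set \<Rightarrow> 'a set \<Rightarrow> bool" where
  "strand indep A B S \<longleftrightarrow>
     S \<subseteq> A \<and> local_conn indep S B = 1 \<and> (\<forall>T. T \<subset> S \<longrightarrow> local_conn indep T B \<noteq> 1)"

text \<open>The independence predicate of the deletion of \<open>P\<close>, a matroid on \<open>E - P\<close>.\<close>

definition deletion :: "('a set \<Rightarrow> bool) \<Rightarrow> 'a set \<Rightarrow> 'a set \<Rightarrow> bool" where
  "deletion indep P I \<longleftrightarrow> indep I \<and> I \<inter> P = {}"

text \<open>
  \<open>extension E indep P indep'\<close>: \<open>(E \<union> P, indep')\<close> is an extension of \<open>(E, indep)\<close> by the set \<open>P\<close>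
  of new elements.
\<close>

definition extension ::
  "'a set \<Rightarrow> ('a set \<Rightarrow> bool) \<Rightarrow> 'a set \<Rightarrow> ('a set \<Rightarrow> bool) \<Rightarrow> bool" where
  "extension E indep P indep' \<longleftrightarrow>
     P \<inter> E = {} \<and> matroid (E \<union> P) indep' \<and> deletion indep' P = indep"

end

theory Submission imports Defs begin

text \<open>
  Let \<open>q\<close> be spanned by a strand \<open>S\<close> of \<open>A\<close> and a strand \<open>T\<close> of \<open>B\<close>, for an exact 3-separation
  \<open>(A, B)\<close>. Contracting \<open>q\<close> leaves a matroid with a 2-separation, glued from \<open>M / T\<close> on \<open>A\<close> and
  \<open>M / S\<close> on \<open>B\<close> like a 2-sum. This fixes the rank function of the extension. Conversely, the glued function is
  always a matroid rank function, so an extension exists as soon as the glued matroid is a quotient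
  of \<open>M\<close>, that is, as soon as the forced span indicator of \<open>q\<close> is monotone. The indicator depends
  only on local connectivities. To add both \<open>p\<close> and \<open>q\<close>, it therefore suffices that in \<open>M + p\<close> every
  subset of \<open>X \<union> Y \<union> {p}\<close> has the same connectivities to subsets of \<open>Z\<close> as some subset of \<open>X \<union> Y\<close>,
  for which monotonicity follows from the existence of \<open>M + q\<close>.
\<close>

section \<open>Rank and local connectivity in a matroid\<close>

context matroid
begin

abbreviation r :: "'a set \<Rightarrow> int" where
  "r U \<equiv> int (rank indep U)"

abbreviation conn :: "'a set \<Rightarrow> 'a set \<Rightarrow> int" where
  "conn \<equiv> local_conn indep"

lemma finite_indep_subsets: "finite {I. I \<subseteq> U \<and> indep I}"
  by (rule finite_subset[of _ "Pow E"]) (use indep_subset_ground finite_ground in auto)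

lemma finite_indep: "indep I \<Longrightarrow> finite I"
  using indep_subset_ground finite_ground finite_subset by blast

lemma card_le_rank: "indep I \<Longrightarrow> I \<subseteq> U \<Longrightarrow> card I \<le> rank indep U"
  unfolding rank_def using finite_indep_subsets by (intro Max_ge) auto

lemma rank_attained: "\<exists>I\<subseteq>U. indep I \<and> card I = rank indep U"
proof -
  have "rank indep U \<in> card ` {I. I \<subseteq> U \<and> indep I}"
    unfolding rank_def using finite_indep_subsets indep_empty by (intro Max_in) auto
  then show ?thesis by auto
qed

lemma rank_mono: "U \<subseteq> V \<Longrightarrow> rank indep U \<le> rank indep V"
  using rank_attained[of U] card_le_rank[of _ V] by fastforce

lemma rank_le_card: "finite U \<Longrightarrow> rank indep U \<le> card U"
  using rank_attained[of U] card_mono by metis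

lemma rank_empty [simp]: "rank indep {} = 0"
  using rank_le_card[of "{}"] by simp

lemma indep_iff_rank: "indep I \<longleftrightarrow> finite I \<and> rank indep I = card I"
proof
  assume "indep I"
  then show "finite I \<and> rank indep I = card I"
    using finite_indep[of I] card_le_rank[of I I] rank_le_card[of I] by auto
next
  assume I: "finite I \<and> rank indep I = card I"
  obtain J where "J \<subseteq> I" "indep J" "card J = rank indep I"
    using rank_attained by blast
  with I show "indep I" using card_subset_eq by metis
qed

lemma indep_extend:
  assumes "indep I" "I \<subseteq> U"
  shows "\<exists>J. I \<subseteq> J \<and> J \<subseteq> U \<and> indep J \<and> card J = rank indep U"
  using assms
proof (induction "rank indep U - card I" arbitrary: I rule: less_induct)
  case less
  show ?case
  proof (cases "card I = rank indep U")
    case True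
    then show ?thesis using less.prems by blast
  next
    case False
    obtain B where B: "B \<subseteq> U" "indep B" "card B = rank indep U"
      using rank_attained by blast
    have lt: "card I < card B"
      using False card_le_rank[OF less.prems] B by simp
    then obtain x where x: "x \<in> B - I" "indep (insert x I)"
      using indep_augment less.prems B by blast
    have "card (insert x I) = Suc (card I)"
      using x finite_indep less.prems by simp
    then have "\<exists>J. insert x I \<subseteq> J \<and> J \<subseteq> U \<and> indep J \<and> card J = rank indep U"
      using x B lt less.prems(2) by (intro less.hyps) auto
    then show ?thesis by blast
  qed
qed

lemma rank_submod:
  "rank indep (U \<union> V) + rank indep (U \<inter> V) \<le> rank indep U + rank indep V"
proof -
  obtain I where I: "I \<subseteq> U \<inter> V" "indep I" "card I = rank indep (U \<inter> V)"
    using rank_attained by blast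
  obtain J where J: "I \<subseteq> J" "J \<subseteq> U \<union> V" "indep J" "card J = rank indep (U \<union> V)"
    using indep_extend[OF I(2), of "U \<union> V"] I by blast
  have fin: "finite J" using J finite_indep by blast
  have JU: "indep (J \<inter> U)" and JV: "indep (J \<inter> V)"
    using J(3) by (auto intro: indep_mono)
  have "card J = card ((J \<inter> U) \<union> (J \<inter> V))"
    using J(2) by (intro arg_cong[where f = card]) auto
  moreover have "card I \<le> card ((J \<inter> U) \<inter> (J \<inter> V))"
    using I J fin by (intro card_mono) auto
  moreover have "card (J \<inter> U) + card (J \<inter> V)
      = card ((J \<inter> U) \<union> (J \<inter> V)) + card ((J \<inter> U) \<inter> (J \<inter> V))"
    using fin by (intro card_Un_Int) auto
  moreover have "card (J \<inter> U) \<le> rank indep U" "card (J \<inter> V) \<le> rank indep V"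
    using card_le_rank JU JV by auto
  ultimately show ?thesis using I J by linarith
qed

lemma rank_submod_subset:
  assumes "C \<subseteq> U \<union> V" "D \<subseteq> U \<inter> V"
  shows "r C + r D \<le> r U + r V"
  using rank_submod[of U V] rank_mono[OF assms(1)] rank_mono[OF assms(2)] by linarith

lemma rank_insert_in_closure:
  assumes "rank indep (insert e U) = rank indep U" "U \<subseteq> V"
  shows "rank indep (insert e V) = rank indep V"
proof -
  have "r (insert e V) + r U \<le> r (insert e U) + r V"
    using assms(2) by (intro rank_submod_subset) auto
  then show ?thesis
    using assms(1) rank_mono[OF subset_insertI[of V e]] by auto
qed

lemma circuit_rank_remove:
  assumes "circuit E' indep (insert e S)" "e \<notin> S"
  shows "rank indep (insert e S) = rank indep S"
proof -
  have S: "indep S" "\<not> indep (insert e S)"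
    using assms unfolding circuit_def by blast+
  then have "finite S" "rank indep S = card S"
    using indep_iff_rank by auto
  moreover have "rank indep (insert e S) \<noteq> card (insert e S)"
    using S calculation indep_iff_rank by auto
  ultimately show ?thesis
    using rank_le_card[of "insert e S"] rank_mono[OF subset_insertI[of S e]] assms(2) by auto
qed

lemma circuit_rank_singleton:
  assumes "circuit E' indep (insert e S)" "e \<notin> S" "S \<noteq> {}"
  shows "rank indep {e} = 1"
proof -
  have "{e} \<subset> insert e S" using assms by auto
  then have "indep {e}" using assms(1) unfolding circuit_def by blast
  then show ?thesis using indep_iff_rank by auto
qed

lemma conn_commute: "conn U V = conn V U"
  by (simp add: local_conn_def Un_commute)

lemma conn_empty [simp]: "conn {} V = 0" "conn V {} = 0"
  by (simp_all add: local_conn_def)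

lemma conn_insert_closure:
  assumes "rank indep (insert e U) = rank indep U"
  shows "conn (insert e U) V = conn U V" "conn V (insert e U) = conn V U"
  using assms rank_insert_in_closure[OF assms, of "U \<union> V"]
  by (simp_all add: local_conn_def Un_commute)

text \<open>Submodularity of the rank at \<open>Q \<union> W\<close> and
  \<open>P \<union> B\<close>, whose intersection contains \<open>P \<union> W\<close>. Taking
  \<open>W\<close> empty gives monotonicity of the connectivity.\<close>

lemma conn_diff_mono:
  assumes "P \<subseteq> Q" "W \<subseteq> B"
  shows "conn P B - conn P W \<le> conn Q B - conn Q W"
proof -
  have "r (Q \<union> B) + r (P \<union> W) \<le> r (Q \<union> W) + r (P \<union> B)"
    using assms by (intro rank_submod_subset) auto
  then show ?thesis by (simp add: local_conn_def)
qed

lemma conn_mono_left: "P \<subseteq> Q \<Longrightarrow> conn P B \<le> conn Q B"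
  using conn_diff_mono[of P Q "{}" B] by simp

lemma conn_mono_right: "P \<subseteq> Q \<Longrightarrow> conn B P \<le> conn B Q"
  using conn_mono_left[of P Q B] by (simp add: conn_commute)

lemma conn_nonneg: "0 \<le> conn U V"
  using conn_mono_left[of "{}" U V] by simp

text \<open>By \<open>conn_diff_mono\<close>, the excess of the connectivity of \<open>Q\<close>
  over that of \<open>P\<close> grows with the second argument, so it vanishes on \<open>W\<close>
  once it vanishes on \<open>B\<close>.\<close>

lemma conn_squeeze:
  assumes "P \<subseteq> Q" "W \<subseteq> B" "conn P B = conn Q B"
  shows "conn P W = conn Q W"
  using conn_diff_mono[OF assms(1,2)] conn_mono_left[OF assms(1), of W] assms(3) by linarith

text \<open>On the right, \<open>H\<close> occurs only through its connectivities to
  \<open>K \<union> W\<close> and \<open>K\<close>. It can therefore be exchanged for any set with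
  the same two values.\<close>

lemma conn_Un_left: "conn (H \<union> K) W = conn K W + conn H (K \<union> W) - conn H K"
  by (simp add: local_conn_def Un_assoc)

end

section \<open>Points in the guts of a separation\<close>

text \<open>
  For \<open>F \<subseteq> A\<close> and \<open>G \<subseteq> B\<close>, this is 1 if a new element in the guts of \<open>(A, B)\<close> spanned by both
  \<open>S\<close> and \<open>T\<close> is spanned by \<open>F \<union> G\<close>, and 0 otherwise.
\<close>

definition guts_span ::
  "('a set \<Rightarrow> bool) \<Rightarrow> 'a set \<Rightarrow> 'a set \<Rightarrow> 'a set \<Rightarrow> 'a set \<Rightarrow> 'a set \<Rightarrow> 'a set \<Rightarrow> int" where
  "guts_span indep A B S T F G =
     local_conn indep F T + local_conn indep S G - local_conn indep F G
     + (local_conn indep F B - local_conn indep F T) * (local_conn indep A G - local_conn indep S G)"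

text \<open>The circuits through \<open>q\<close> enter as rank conditions: \<open>q\<close> is a
  nonloop in the closures of \<open>S\<close> and \<open>T\<close>. This form survives enlarging
  \<open>A\<close> by a point of its closure.\<close>

definition guts_point ::
  "('a set \<Rightarrow> bool) \<Rightarrow> 'a set \<Rightarrow> 'a set \<Rightarrow> 'a set \<Rightarrow> 'a set \<Rightarrow> 'a \<Rightarrow> bool" where
  "guts_point indep A B S T q \<longleftrightarrow>
     local_conn indep A B = 2 \<and> S \<subseteq> A \<and> T \<subseteq> B \<and>
     local_conn indep S B = 1 \<and> local_conn indep A T = 1 \<and>
     rank indep (insert q S) = rank indep S \<and> rank indep (insert q T) = rank indep T \<and>
     rank indep {q} = 1"

text \<open>The three terms of \<open>r ?F + r ?G - conn ?F ?G\<close> are all forced. Being in the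
  closures of both \<open>T\<close> and \<open>A\<close>, \<open>q\<close> makes the connectivity of
  \<open>?F\<close> to \<open>T\<close> exactly 1, which gives \<open>r ?F\<close>; symmetrically
  for \<open>?G\<close>.\<close>

lemma (in matroid) rank_insert_guts:
  assumes guts: "guts_point indep A B S T q" and F: "F \<subseteq> A" and G: "G \<subseteq> B"
  shows "r (insert q (F \<union> G)) = r (F \<union> G) + 1 - guts_span indep A B S T F G"
proof -
  have AB: "conn A B = 2" and SA: "S \<subseteq> A" and TB: "T \<subseteq> B"
    and SB: "conn S B = 1" and AT: "conn A T = 1"
    and qS: "rank indep (insert q S) = rank indep S"
    and qT: "rank indep (insert q T) = rank indep T"
    and q: "rank indep {q} = 1"
    using guts by (simp_all add: guts_point_def)
  let ?F = "insert q F" and ?G = "insert q G"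
  have clS: "rank indep (insert q U) = rank indep U" if "S \<subseteq> U" for U
    using rank_insert_in_closure[OF qS that] .
  have clT: "rank indep (insert q U) = rank indep U" if "T \<subseteq> U" for U
    using rank_insert_in_closure[OF qT that] .
  note qA = clS[OF SA] and qB = clT[OF TB]
  have conn_q: "conn {q} W = 1" if "rank indep (insert q W) = rank indep W" for W
    using that q by (simp add: local_conn_def)
  have "conn {q} T \<le> conn ?F T" "conn ?F T \<le> conn (insert q A) T"
    using F by (auto intro!: conn_mono_left)
  then have "conn ?F T = 1"
    using conn_q[OF qT] AT conn_insert_closure(1)[OF qA, of T] by simp
  then have rF: "r ?F = r F + 1 - conn F T"
    using clT[of "F \<union> T"] by (simp add: local_conn_def)
  have "conn {q} S \<le> conn ?G S" "conn ?G S \<le> conn (insert q B) S"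
    using G by (auto intro!: conn_mono_left)
  then have "conn ?G S = 1"
    using conn_q[OF qS] SB conn_insert_closure(1)[OF qB, of S] conn_commute by simp
  then have rG: "r ?G = r G + 1 - conn S G"
    using clS[of "G \<union> S"] by (simp add: local_conn_def Un_commute)
  have FB: "conn ?F (insert q B) = 1 + (conn F B - conn F T)"
    unfolding conn_insert_closure[OF qB]
    using rF clT[of "F \<union> B"] TB by (auto simp: local_conn_def)
  have AG: "conn (insert q A) ?G = 1 + (conn A G - conn S G)"
    unfolding conn_insert_closure[OF qA]
    using rG clS[of "A \<union> G"] SA by (auto simp: local_conn_def)
  have AB': "conn (insert q A) (insert q B) = 2"
    using AB conn_insert_closure[OF qA] conn_insert_closure[OF qB] by simp
  have lo: "conn {q} ?G \<le> conn ?F ?G"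
    by (auto intro!: conn_mono_left)
  have hi: "conn ?F ?G \<le> conn ?F (insert q B)"
    using G by (auto intro!: conn_mono_right)
  have up: "conn ?F (insert q B) \<le> conn (insert q A) (insert q B)"
    using F by (auto intro!: conn_mono_left)
  have q1: "conn {q} ?G = 1" using conn_q[of ?G] by simp
  \<comment> \<open>The connectivity of \<open>?F\<close> to \<open>insert q B\<close> is 1 or 2. At
    1, the value at \<open>?G\<close> is caught between 1 and 1; at 2, \<open>?F\<close> already
    attains the connectivity of the whole left side and can be replaced by
    \<open>insert q A\<close>.\<close>
  have FG: "conn ?F ?G = 1 + (conn F B - conn F T) * (conn A G - conn S G)"
  proof (cases "conn ?F (insert q B) = 1")
    case True
    then have "conn F B - conn F T = 0" "conn ?F ?G = 1" using lo hi q1 FB by linarith+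
    then show ?thesis by simp
  next
    case False
    then have two: "conn ?F (insert q B) = 2" using lo hi up q1 AB' by linarith
    have "conn ?F ?G = conn (insert q A) ?G"
      by (rule conn_squeeze[of _ _ _ "insert q B"]) (use F G AB' two in auto)
    moreover have "conn F B - conn F T = 1" using FB two by linarith
    ultimately show ?thesis using AG by simp
  qed
  have "conn ?F ?G = r ?F + r ?G - r (insert q (F \<union> G))" "conn F G = r F + r G - r (F \<union> G)"
    by (simp_all add: local_conn_def)
  then show ?thesis
    using rF rG FG unfolding guts_span_def by linarith
qed

section \<open>Matroids from rank functions, and ranks in extensions\<close>

text \<open>The key is \<open>span\<close>: by submodularity, elements that separately add nothing
  to \<open>I\<close> add nothing together. Augmentation follows, since otherwise
  \<open>\<rho> J\<close> would be at most \<open>\<rho> I\<close>; so does the rank formula, since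
  a largest independent subset of \<open>U\<close> spans \<open>U\<close>.\<close>

lemma matroid_of_rank_function:
  fixes \<rho> :: "'a set \<Rightarrow> int"
  assumes fin: "finite E" and empty: "\<rho> {} = 0"
    and bound: "\<And>S. S \<subseteq> E \<Longrightarrow> \<rho> S \<le> int (card S)"
    and mono: "\<And>S T. S \<subseteq> T \<Longrightarrow> T \<subseteq> E \<Longrightarrow> \<rho> S \<le> \<rho> T"
    and submod: "\<And>S T. S \<subseteq> E \<Longrightarrow> T \<subseteq> E \<Longrightarrow> \<rho> (S \<union> T) + \<rho> (S \<inter> T) \<le> \<rho> S + \<rho> T"
  defines "ind \<equiv> \<lambda>I. I \<subseteq> E \<and> \<rho> I = int (card I)"
  shows "matroid E ind" "\<And>U. U \<subseteq> E \<Longrightarrow> int (rank ind U) = \<rho> U"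
proof -
  have finS: "finite S" if "S \<subseteq> E" for S
    using that fin finite_subset by blast
  have span: "\<rho> (I \<union> K) = \<rho> I"
    if "I \<subseteq> E" "K \<subseteq> E" "\<And>x. x \<in> K \<Longrightarrow> \<rho> (insert x I) = \<rho> I" for I K
    using finS[OF that(2)] that(2,3)
  proof (induction K rule: finite_induct)
    case empty
    then show ?case by simp
  next
    case (insert x K)
    have "\<rho> (insert x I \<union> (I \<union> K)) + \<rho> (insert x I \<inter> (I \<union> K)) \<le> \<rho> (insert x I) + \<rho> (I \<union> K)"
      using insert.prems \<open>I \<subseteq> E\<close> by (intro submod) auto
    moreover have "\<rho> I \<le> \<rho> (insert x I \<inter> (I \<union> K))" "\<rho> I \<le> \<rho> (I \<union> insert x K)"
      using insert.prems \<open>I \<subseteq> E\<close> by (auto intro!: mono)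
    moreover have "\<rho> (insert x I) = \<rho> I" "\<rho> (I \<union> K) = \<rho> I"
      using insert by auto
    moreover have "insert x I \<union> (I \<union> K) = I \<union> insert x K" by auto
    ultimately show ?case by simp
  qed
  have step: "\<rho> (insert x I) = \<rho> I" if "ind I" "x \<in> E" "\<not> ind (insert x I)" for x I
  proof (cases "x \<in> I")
    case True
    then show ?thesis by (simp add: insert_absorb)
  next
    case False
    have I: "I \<subseteq> E" "\<rho> I = int (card I)" using that by (auto simp: ind_def)
    then have "\<rho> (insert x I) \<noteq> int (card I) + 1"
      using that finS False by (auto simp: ind_def)
    moreover have "\<rho> (insert x I) \<le> int (card I) + 1"
      using bound[of "insert x I"] I that finS False by simp
    moreover have "\<rho> I \<le> \<rho> (insert x I)"
      using I that by (intro mono) auto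
    ultimately show ?thesis using I by linarith
  qed
  show mat: "matroid E ind"
  proof
    show "finite E" by fact
    show "I \<subseteq> E" if "ind I" for I using that by (simp add: ind_def)
    show "ind {}" by (simp add: ind_def empty)
    show "ind J" if "ind I" "J \<subseteq> I" for I J
    proof -
      have I: "I \<subseteq> E" "\<rho> I = int (card I)" using that by (auto simp: ind_def)
      \<comment> \<open>Both pieces of \<open>I\<close> are bounded by their cardinalities, and
        these bounds add up to \<open>\<rho> I\<close>, so both are attained.\<close>
      have "\<rho> (J \<union> (I - J)) + \<rho> (J \<inter> (I - J)) \<le> \<rho> J + \<rho> (I - J)"
        using I that by (intro submod) auto
      moreover have "J \<union> (I - J) = I" using that by auto
      moreover have "\<rho> (I - J) \<le> int (card (I - J))" "\<rho> J \<le> int (card J)"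
        using I that by (auto intro!: bound)
      moreover have "card (I - J) + card J = card I"
        using that I finS[of I] finS[of J]
        by (metis card_Diff_subset card_mono le_add_diff_inverse2 order_trans)
      ultimately have "\<rho> J = int (card J)"
        using I by (simp add: empty)
      then show ?thesis using I that by (auto simp: ind_def)
    qed
    show "\<exists>x\<in>J - I. ind (insert x I)" if IJ: "ind I" "ind J" "card I < card J" for I J
    proof (rule ccontr)
      assume "\<not> ?thesis"
      then have "\<rho> (insert x I) = \<rho> I" if "x \<in> J" for x
        using step[OF IJ(1), of x] that IJ(2)
        by (cases "x \<in> I") (auto simp: ind_def insert_absorb)
      then have "\<rho> (I \<union> J) = \<rho> I"
        using IJ by (intro span) (auto simp: ind_def)
      moreover have "\<rho> J \<le> \<rho> (I \<union> J)"
        using IJ by (intro mono) (auto simp: ind_def)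
      ultimately show False using IJ by (simp add: ind_def)
    qed
  qed
  show "int (rank ind U) = \<rho> U" if U: "U \<subseteq> E" for U
  proof -
    interpret N: matroid E ind by (rule mat)
    obtain I where I: "I \<subseteq> U" "ind I" "card I = rank ind U"
      using N.rank_attained by blast
    have "\<rho> (insert x I) = \<rho> I" if "x \<in> U" for x
    proof (rule ccontr)
      assume ne: "\<rho> (insert x I) \<noteq> \<rho> I"
      then have x: "x \<notin> I" by (auto simp: insert_absorb)
      have "ind (insert x I)" using ne step[OF I(2)] that U by blast
      then have "card (insert x I) \<le> rank ind U"
        using I that by (intro N.card_le_rank) auto
      then show False using x I N.finite_indep by simp
    qed
    then have "\<rho> (I \<union> U) = \<rho> I"
      using I U by (intro span) auto
    then show ?thesis using I by (simp add: ind_def Un_absorb1)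
  qed
qed

lemma rank_extension:
  assumes "extension E indep P indep'" "U \<inter> P = {}"
  shows "rank indep' U = rank indep U"
proof -
  have "{I. I \<subseteq> U \<and> indep' I} = {I. I \<subseteq> U \<and> indep I}"
    using assms unfolding extension_def deletion_def by blast
  then show ?thesis by (simp add: rank_def)
qed

lemma local_conn_extension:
  assumes "extension E indep P indep'" "U \<inter> P = {}" "V \<inter> P = {}"
  shows "local_conn indep' U V = local_conn indep U V"
  using assms rank_extension[OF assms(1)] by (simp add: local_conn_def Int_Un_distrib2)

section \<open>Gluing two rank functions, and the extension by one guts point\<close>

text \<open>The four values of each variable belong to a union, an intersection and the two sets
  themselves. If an indicator is constant on them, the glued function is a sum of two functions
  assumed submodular; otherwise both indicators rise from 0 to 1.\<close>

lemma glue_submod: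
  fixes au ai a1 a2 bu bi b1 b2 :: int
  assumes "\<tau>u \<in> {0,1}" "\<tau>i \<in> {0,1}" "\<tau>1 \<in> {0,1}" "\<tau>2 \<in> {0,1::int}"
    "\<sigma>u \<in> {0,1}" "\<sigma>i \<in> {0,1}" "\<sigma>1 \<in> {0,1}" "\<sigma>2 \<in> {0,1::int}"
    "\<tau>i \<le> \<tau>1" "\<tau>i \<le> \<tau>2" "\<tau>1 \<le> \<tau>u" "\<tau>2 \<le> \<tau>u"
    "\<sigma>i \<le> \<sigma>1" "\<sigma>i \<le> \<sigma>2" "\<sigma>1 \<le> \<sigma>u" "\<sigma>2 \<le> \<sigma>u"
    "au + ai \<le> a1 + a2" "au - \<tau>u + (ai - \<tau>i) \<le> a1 - \<tau>1 + (a2 - \<tau>2)"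
    "bu + bi \<le> b1 + b2" "bu - \<sigma>u + (bi - \<sigma>i) \<le> b1 - \<sigma>1 + (b2 - \<sigma>2)"
  shows "(au + bu - \<tau>u * \<sigma>u) + (ai + bi - \<tau>i * \<sigma>i)
     \<le> (a1 + b1 - \<tau>1 * \<sigma>1) + (a2 + b2 - \<tau>2 * \<sigma>2)"
proof -
  consider "\<sigma>i = 1" | "\<sigma>u = 0" | "\<tau>i = 1" | "\<tau>u = 0"
    | "\<sigma>i = 0" "\<sigma>u = 1" "\<tau>i = 0" "\<tau>u = 1"
    using assms(1,2,5,6) by blast
  then show ?thesis
  proof cases
    case 1
    then have "\<sigma>1 = 1" "\<sigma>2 = 1" "\<sigma>u = 1" using assms(5-8,13-16) by auto
    with 1 assms(18,19) show ?thesis by simp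
  next
    case 2
    then have "\<sigma>1 = 0" "\<sigma>2 = 0" "\<sigma>i = 0" using assms(5-8,13-16) by auto
    with 2 assms(17,19) show ?thesis by simp
  next
    case 3
    then have "\<tau>1 = 1" "\<tau>2 = 1" "\<tau>u = 1" using assms(1-4,9-12) by auto
    with 3 assms(17,20) show ?thesis by simp
  next
    case 4
    then have "\<tau>1 = 0" "\<tau>2 = 0" "\<tau>i = 0" using assms(1-4,9-12) by auto
    with 4 assms(17,19) show ?thesis by simp
  next
    case 5
    \<comment> \<open>The left side loses 1, at the union. If \<open>\<tau>1 + \<tau>2\<close> is 2,
      the inequality for \<open>a - \<tau>\<close> gives one unit more than that for
      \<open>a\<close>; otherwise at most one product on the right is nonzero.\<close>
    have "\<tau>1 * \<sigma>1 + \<tau>2 * \<sigma>2 \<le> max 1 (\<tau>1 + \<tau>2)"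
      using assms(3,4,7,8) by auto
    with 5 assms(17-19) show ?thesis by simp
  qed
qed

lemma glue_mono:
  fixes a1 a2 b1 b2 :: int
  assumes "\<tau>1 \<in> {0,1}" "\<tau>2 \<in> {0,1::int}" "\<sigma>1 \<in> {0,1}" "\<sigma>2 \<in> {0,1::int}"
    "a1 \<le> a2" "a1 - \<tau>1 \<le> a2 - \<tau>2" "b1 \<le> b2" "b1 - \<sigma>1 \<le> b2 - \<sigma>2"
    "\<tau>1 \<le> \<tau>2" "\<sigma>1 \<le> \<sigma>2"
  shows "a1 + b1 - \<tau>1 * \<sigma>1 \<le> a2 + b2 - \<tau>2 * \<sigma>2"
proof (cases "\<tau>2 = 0 \<or> \<sigma>2 = 0")
  case True
  then show ?thesis using assms by auto
next
  case False
  then have "\<tau>2 = 1" "\<sigma>2 = 1" using assms by auto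
  then show ?thesis using assms(1,3,5-8) by auto
qed

text \<open>The function \<open>r - \<delta>\<close> is designed as the rank function after
  contracting \<open>q\<close>. Gluing makes it submodular and monotone, and monotonicity of
  \<open>\<delta>\<close> makes it compatible with \<open>r\<close>, so that both fit into one rank
  function on \<open>insert q E\<close>.\<close>

lemma (in matroid) guts_extension_exists:
  assumes E: "A \<union> B = E" "A \<inter> B = {}" and qE: "q \<notin> E"
    and AB: "conn A B = 2" and SA: "S \<subseteq> A" and TB: "T \<subseteq> B"
    and SB: "conn S B = 1" and AT: "conn A T = 1"
    and span_mono: "\<And>F F' G G'. F \<subseteq> F' \<Longrightarrow> F' \<subseteq> A \<Longrightarrow> G \<subseteq> G' \<Longrightarrow> G' \<subseteq> B \<Longrightarrow>
      guts_span indep A B S T F G \<le> guts_span indep A B S T F' G'"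
  shows "\<exists>indep'. extension E indep {q} indep' \<and> (\<forall>F G. F \<subseteq> A \<longrightarrow> G \<subseteq> B \<longrightarrow>
    int (rank indep' (insert q (F \<union> G))) = r (F \<union> G) + 1 - guts_span indep A B S T F G)"
proof -
  define \<delta> where "\<delta> U = guts_span indep A B S T (U \<inter> A) (U \<inter> B)" for U
  define \<tau> where "\<tau> U = conn (U \<inter> A) B - conn (U \<inter> A) T" for U
  define \<sigma> where "\<sigma> U = conn A (U \<inter> B) - conn S (U \<inter> B)" for U
  \<comment> \<open>These are the ranks of \<open>U \<inter> A\<close> after contracting
    \<open>T\<close> and of \<open>U \<inter> B\<close> after contracting \<open>S\<close>.\<close>
  define a where "a U = r (U \<inter> A \<union> T) - r T" for U
  define b where "b U = r (U \<inter> B \<union> S) - r S" for U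
  have split: "U \<inter> A \<union> U \<inter> B = U" if "U \<subseteq> E" for U using that E by auto
  have quot: "r U - \<delta> U = a U + b U - \<tau> U * \<sigma> U" if "U \<subseteq> E" for U
    using split[OF that]
    by (simp add: \<delta>_def \<tau>_def \<sigma>_def a_def b_def guts_span_def local_conn_def Un_commute)
  have \<tau>_mono: "\<tau> U \<le> \<tau> V" if "U \<subseteq> V" for U V
    unfolding \<tau>_def using that TB by (intro conn_diff_mono) auto
  have \<sigma>_mono: "\<sigma> U \<le> \<sigma> V" if "U \<subseteq> V" for U V
    unfolding \<sigma>_def using that SA conn_diff_mono[of "U \<inter> B" "V \<inter> B" S A]
    by (auto simp: conn_commute)
  \<comment> \<open>By monotonicity the extreme values are attained at \<open>A\<close> and
    \<open>B\<close>, where the difference is 2 - 1.\<close>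
  have "\<tau> U \<le> 1" "\<sigma> U \<le> 1" for U
    using conn_diff_mono[of "U \<inter> A" A T B] conn_diff_mono[of "U \<inter> B" B S A] SA TB AB AT SB
    by (auto simp: \<tau>_def \<sigma>_def conn_commute)
  moreover have "0 \<le> \<tau> U" "0 \<le> \<sigma> U" for U
    using conn_mono_right[OF TB] conn_mono_left[OF SA] by (auto simp: \<tau>_def \<sigma>_def)
  ultimately have "\<tau> U = 0 \<or> \<tau> U = 1" "\<sigma> U = 0 \<or> \<sigma> U = 1" for U
    by (metis dual_order.antisym int_one_le_iff_zero_less order_le_less)+
  then have range: "\<tau> U \<in> {0,1}" "\<sigma> U \<in> {0,1}" for U
    by blast+
  \<comment> \<open>Subtracting the indicators turns the contraction of \<open>T\<close> into that
    of \<open>B\<close>, and the contraction of \<open>S\<close> into that of \<open>A\<close>.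
    These are again submodular and monotone, as the gluing lemmas require.\<close>
  have a\<tau>: "a U - \<tau> U = r (U \<inter> A \<union> B) - r B" for U
    by (simp add: a_def \<tau>_def local_conn_def)
  have b\<sigma>: "b U - \<sigma> U = r (U \<inter> B \<union> A) - r A" for U
    by (simp add: b_def \<sigma>_def local_conn_def Un_commute)
  have slice: "r ((U \<union> V) \<inter> C \<union> D) + r (U \<inter> V \<inter> C \<union> D) \<le> r (U \<inter> C \<union> D) + r (V \<inter> C \<union> D)"
    for U V C D
    by (rule rank_submod_subset) auto
  have slice_mono: "r (U \<inter> C \<union> D) \<le> r (V \<inter> C \<union> D)" if "U \<subseteq> V" for U V C D
    using that by (auto intro!: rank_mono)
  have submod: "r (U \<union> V) - \<delta> (U \<union> V) + (r (U \<inter> V) - \<delta> (U \<inter> V))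
      \<le> r U - \<delta> U + (r V - \<delta> V)" if "U \<subseteq> E" "V \<subseteq> E" for U V
  proof -
    have "U \<union> V \<subseteq> E" "U \<inter> V \<subseteq> E" using that by auto
    then show ?thesis
      unfolding quot[OF that(1)] quot[OF that(2)] quot[OF \<open>U \<union> V \<subseteq> E\<close>] quot[OF \<open>U \<inter> V \<subseteq> E\<close>]
      using slice[of U V A T] slice[of U V B S] slice[of U V A B] slice[of U V B A]
      by (intro glue_submod range \<tau>_mono \<sigma>_mono; (unfold a\<tau> b\<sigma>)?) (auto simp: a_def b_def)
  qed
  have mono: "r U - \<delta> U \<le> r V - \<delta> V" if "U \<subseteq> V" "V \<subseteq> E" for U V
  proof -
    have "U \<subseteq> E" using that by auto
    show ?thesis
      unfolding quot[OF that(2)] quot[OF \<open>U \<subseteq> E\<close>]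
      using slice_mono[OF that(1)] that(1)
      by (intro glue_mono range \<tau>_mono \<sigma>_mono; (unfold a\<tau> b\<sigma>)?) (auto simp: a_def b_def)
  qed
  have \<delta>_mono: "\<delta> U \<le> \<delta> V" if "U \<subseteq> V" for U V
    unfolding \<delta>_def using that by (intro span_mono) auto
  have \<delta>_empty: "\<delta> {} = 0"
    by (simp add: \<delta>_def guts_span_def)
  \<comment> \<open>At \<open>E\<close> the connectivity terms cancel, 1 + 1 - 2, and the product is
    1. Together with \<open>\<delta>_empty\<close> and monotonicity this bounds
    \<open>\<delta>\<close> by 0 and 1.\<close>
  have "E \<inter> A = A" "E \<inter> B = B" using E by auto
  then have "\<delta> E = 1"
    using AB SB AT by (simp add: \<delta>_def guts_span_def)
  then have \<delta>_range: "0 \<le> \<delta> U" "\<delta> U \<le> 1" if "U \<subseteq> E" for U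
    using \<delta>_mono[of "{}" U] \<delta>_mono[OF that] \<delta>_empty by auto
  \<comment> \<open>A set containing \<open>q\<close> has the rank of the rest after contracting
    \<open>q\<close>, plus 1 for \<open>q\<close> itself.\<close>
  define \<rho> where "\<rho> U = (if q \<in> U then r (U - {q}) - \<delta> (U - {q}) + 1 else r U)" for U
  define ind where "ind = (\<lambda>I. I \<subseteq> insert q E \<and> \<rho> I = int (card I))"
  \<comment> \<open>Submodularity of \<open>\<rho>\<close> when only \<open>V\<close> gains
    \<open>q\<close>: the intersection then avoids \<open>q\<close> and is measured by
    \<open>r\<close>. Monotonicity of \<open>\<delta>\<close> pays for this change.\<close>
  have mixed: "r U + (r V - \<delta> V) \<ge> r (U \<inter> V) + (r (U \<union> V) - \<delta> (U \<union> V))"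
    if "U \<subseteq> E" "V \<subseteq> E" for U V
    using submod[OF that] \<delta>_mono[of "U \<inter> V" U] by simp
  have finE: "finite (insert q E)" using finite_ground by simp
  have bound: "\<rho> U \<le> int (card U)" if "U \<subseteq> insert q E" for U
  proof (cases "q \<in> U")
    case True
    have fin: "finite U" using that finE finite_subset by blast
    then have "r (U - {q}) \<le> int (card (U - {q}))" using rank_le_card by simp
    moreover have "0 \<le> \<delta> (U - {q})" using that by (intro \<delta>_range) auto
    moreover have "\<rho> U = r (U - {q}) - \<delta> (U - {q}) + 1" using True by (simp add: \<rho>_def)
    moreover note card.remove[OF fin True]
    ultimately show ?thesis by linarith
  next
    case False
    then show ?thesis
      using rank_le_card[of U] that finE finite_subset by (auto simp: \<rho>_def)
  qed
  have \<rho>_mono: "\<rho> U \<le> \<rho> V" if "U \<subseteq> V" "V \<subseteq> insert q E" for U V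
  proof -
    have U: "U - {q} \<subseteq> V - {q}" and V: "V - {q} \<subseteq> E" using that by auto
    have "r (U - {q}) \<le> r (V - {q})" using rank_mono[OF U] by simp
    then show ?thesis
      using that mono[OF U V] \<delta>_range(2)[OF V] by (auto simp: \<rho>_def)
  qed
  have \<rho>_submod: "\<rho> (U \<union> V) + \<rho> (U \<inter> V) \<le> \<rho> U + \<rho> V"
    if "U \<subseteq> insert q E" "V \<subseteq> insert q E" for U V
  proof -
    let ?U = "U - {q}" and ?V = "V - {q}"
    have UV: "?U \<subseteq> E" "?V \<subseteq> E" using that by auto
    have \<rho>: "\<rho> W = (if q \<in> W then r (W - {q}) - \<delta> (W - {q}) + 1 else r (W - {q}))" for W
      by (simp add: \<rho>_def)
    have eq: "U \<union> V - {q} = ?U \<union> ?V" "U \<inter> V - {q} = ?U \<inter> ?V" by auto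
    have "r (?U \<union> ?V) + r (?U \<inter> ?V) \<le> r ?U + r ?V"
      by (rule rank_submod_subset) auto
    moreover have "r ?V + (r ?U - \<delta> ?U) \<ge> r (?U \<inter> ?V) + (r (?U \<union> ?V) - \<delta> (?U \<union> ?V))"
      using mixed[OF UV(2,1)] by (simp only: Un_commute Int_commute)
    moreover note submod[OF UV] mixed[OF UV]
    ultimately show ?thesis
      unfolding \<rho>[of "U \<union> V"] \<rho>[of "U \<inter> V"] \<rho>[of U] \<rho>[of V] eq
      by (cases "q \<in> U"; cases "q \<in> V"; simp only: Un_iff Int_iff if_True if_False simp_thms; linarith)
  qed
  have "\<rho> {} = 0" by (simp add: \<rho>_def)
  note mat = matroid_of_rank_function[of "insert q E" \<rho>,
      OF finE this bound \<rho>_mono \<rho>_submod, folded ind_def]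
  have "ind I \<and> I \<inter> {q} = {} \<longleftrightarrow> indep I" for I
  proof
    assume "ind I \<and> I \<inter> {q} = {}"
    then show "indep I"
      using finE finite_subset by (auto simp: ind_def \<rho>_def indep_iff_rank)
  next
    assume "indep I"
    then show "ind I \<and> I \<inter> {q} = {}"
      using indep_subset_ground[of I] qE indep_iff_rank[of I] by (auto simp: ind_def \<rho>_def)
  qed
  then have "extension E indep {q} ind"
    using mat(1) qE unfolding extension_def deletion_def by auto
  moreover have "int (rank ind (insert q (F \<union> G))) = r (F \<union> G) + 1 - guts_span indep A B S T F G"
    if FG: "F \<subseteq> A" "G \<subseteq> B" for F G
  proof -
    have "insert q (F \<union> G) - {q} = F \<union> G" "(F \<union> G) \<inter> A = F" "(F \<union> G) \<inter> B = G"
      using FG E qE by auto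
    moreover have "insert q (F \<union> G) \<subseteq> insert q E" using FG E by auto
    ultimately show ?thesis
      using mat(2)[of "insert q (F \<union> G)"] by (simp add: \<rho>_def \<delta>_def)
  qed
  ultimately show ?thesis by blast
qed

section \<open>Monotonicity of the span indicator, also after adding another guts point\<close>

context matroid
begin

text \<open>With \<open>q\<close> present in the matroid, \<open>rank_insert_guts\<close> makes the
  indicator 1 minus the rank gain from \<open>q\<close>, and rank gains decrease by
  submodularity.\<close>

lemma guts_span_mono:
  assumes guts: "guts_point indep A B S T q"
    and F: "F \<subseteq> F'" "F' \<subseteq> A" and G: "G \<subseteq> G'" "G' \<subseteq> B"
  shows "guts_span indep A B S T F G \<le> guts_span indep A B S T F' G'"
proof -
  have "F \<subseteq> A" "G \<subseteq> B" using F G by auto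
  moreover have "r (insert q (F' \<union> G')) + r (F \<union> G) \<le> r (insert q (F \<union> G)) + r (F' \<union> G')"
    using F G by (intro rank_submod_subset) auto
  ultimately show ?thesis
    using rank_insert_guts[OF guts, of F G] rank_insert_guts[OF guts F(2) G(2)] by linarith
qed

lemma guts_point_rank_insert:
  assumes "guts_point indep A B S T q" "S \<subseteq> U \<or> T \<subseteq> U"
  shows "rank indep (insert q U) = rank indep U"
  using assms rank_insert_in_closure unfolding guts_point_def by metis

lemma guts_point_insert_left:
  assumes "guts_point indep A B S T q" "rank indep (insert p A) = rank indep A"
  shows "guts_point indep (insert p A) B S T q"
  using assms conn_insert_closure[OF assms(2)] by (auto simp: guts_point_def)

text \<open>
  Seen from \<open>B\<close>, a subset of \<open>A \<union> {p}\<close> containing the guts point \<open>p\<close> looks like \<open>S\<close> if its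
  connectivity to \<open>B\<close> is 1, and like \<open>A\<close> if it is 2.
\<close>

lemma guts_point_profile:
  assumes guts: "guts_point indep A B S T p" and P: "P \<subseteq> P'" "P' \<subseteq> insert p A"
  shows "\<exists>H H'. H \<subseteq> H' \<and> H' \<subseteq> A \<and> (\<forall>W\<subseteq>B. conn P W = conn H W \<and> conn P' W = conn H' W)"
proof -
  have AB: "conn A B = 2" and SA: "S \<subseteq> A" and TB: "T \<subseteq> B" and SB: "conn S B = 1"
    and pS: "rank indep (insert p S) = rank indep S" and p: "rank indep {p} = 1"
    using guts by (simp_all add: guts_point_def)
  have pA: "rank indep (insert p A) = rank indep A"
    using guts_point_rank_insert[OF guts] SA by blast
  have pB: "conn {p} B = 1"
    using guts_point_rank_insert[OF guts, of B] TB p by (simp add: local_conn_def)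
  \<comment> \<open>The point \<open>p\<close> alone already has connectivity 1 to \<open>B\<close>.
    Hence \<open>Q\<close> and \<open>insert p S\<close> both agree with \<open>{p}\<close> on all
    subsets of \<open>B\<close>.\<close>
  have one: "conn Q W = conn S W" if "p \<in> Q" "conn Q B = 1" "W \<subseteq> B" for Q W
  proof -
    have "conn {p} W = conn Q W"
      by (rule conn_squeeze[of _ _ _ B]) (use that pB in auto)
    moreover have "conn {p} W = conn (insert p S) W"
      by (rule conn_squeeze[of _ _ _ B])
        (use that pB SB conn_insert_closure(1)[OF pS, of B] in auto)
    ultimately show ?thesis using conn_insert_closure(1)[OF pS] by simp
  qed
  have two: "conn Q W = conn A W" if "Q \<subseteq> insert p A" "conn Q B = 2" "W \<subseteq> B" for Q W
  proof -
    have "conn Q W = conn (insert p A) W"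
      by (rule conn_squeeze[of _ _ _ B])
        (use that AB conn_insert_closure(1)[OF pA, of B] in auto)
    then show ?thesis using conn_insert_closure(1)[OF pA] by simp
  qed
  have bounds: "1 \<le> conn Q B" "conn Q B \<le> 2" if "p \<in> Q" "Q \<subseteq> insert p A" for Q
    using that conn_mono_left[of "{p}" Q B] conn_mono_left[of Q "insert p A" B] pB AB
      conn_insert_closure(1)[OF pA, of B] by auto
  have PP': "conn P B \<le> conn P' B" using conn_mono_left[OF P(1)] .
  show ?thesis
  proof (cases "p \<in> P'")
    case False
    then show ?thesis using P by (intro exI[of _ P] exI[of _ P']) auto
  next
    case p': True
    then consider "conn P' B = 1" | "conn P' B = 2" using bounds P(2) by fastforce
    then show ?thesis
    proof cases
      case 1
      show ?thesis
      proof (cases "conn P B = 1")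
        case True
        then have "conn P W = conn S W" if "W \<subseteq> B" for W
          using conn_squeeze[OF P(1) that] 1 one[OF p' 1 that] by simp
        then show ?thesis using one[OF p' 1] SA by (intro exI[of _ S]) auto
      next
        case False
        then have "conn P B = 0" using PP' 1 conn_nonneg[of P B] by linarith
        then have "conn P W = 0" if "W \<subseteq> B" for W
          using conn_mono_right[OF that, of P] conn_nonneg[of P W] by linarith
        then show ?thesis using one[OF p' 1] SA by (intro exI[of _ "{}"] exI[of _ S]) auto
      qed
    next
      case 2
      \<comment> \<open>Here \<open>P'\<close> is represented by all of \<open>A\<close>, so every
        choice of \<open>H\<close> inside \<open>A\<close> is automatically nested.\<close>
      have "\<exists>H\<subseteq>A. \<forall>W\<subseteq>B. conn P W = conn H W"
      proof (cases "p \<in> P")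
        case True
        have PA: "P \<subseteq> insert p A" using P by auto
        then consider "conn P B = 1" | "conn P B = 2" using bounds[OF True] by fastforce
        then show ?thesis
        proof cases
          case 1
          then show ?thesis using one[OF True] SA by (intro exI[of _ S]) auto
        next
          case 2
          then show ?thesis using two[OF PA] by (intro exI[of _ A]) auto
        qed
      next
        case False
        then show ?thesis using P by auto
      qed
      then obtain H where H: "H \<subseteq> A" "\<And>W. W \<subseteq> B \<Longrightarrow> conn P W = conn H W" by blast
      then show ?thesis
        by (intro exI[of _ H] exI[of _ A] conjI order_refl allI impI H two[OF P(2) 2])
    qed
  qed
qed

text \<open>Split \<open>F\<close> into \<open>P\<close> inside \<open>insert p X\<close> and
  \<open>K\<close> inside \<open>Y\<close>. \<open>guts_point_profile\<close> replaces
  \<open>P\<close> by a subset \<open>H\<close> of \<open>X\<close> with the same connectivities to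
  subsets of \<open>Y \<union> Z\<close>, and \<open>conn_Un_left\<close> shows that
  \<open>Z\<close> cannot distinguish \<open>F\<close> from \<open>H \<union> K\<close>. The choices
  for \<open>F\<close> and \<open>F'\<close> are nested, so \<open>span_mono\<close>
  applies.\<close>

lemma guts_span_mono_insert:
  assumes guts: "guts_point indep X (Y \<union> Z) X0 Y0 p" and TZ: "T \<subseteq> Z"
    and span_mono: "\<And>F F' G G'. F \<subseteq> F' \<Longrightarrow> F' \<subseteq> X \<union> Y \<Longrightarrow> G \<subseteq> G' \<Longrightarrow> G' \<subseteq> Z \<Longrightarrow>
      guts_span indep (X \<union> Y) Z S T F G \<le> guts_span indep (X \<union> Y) Z S T F' G'"
    and F: "F \<subseteq> F'" "F' \<subseteq> insert p (X \<union> Y)" and G: "G \<subseteq> G'" "G' \<subseteq> Z"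
  shows "guts_span indep (insert p (X \<union> Y)) Z S T F G
    \<le> guts_span indep (insert p (X \<union> Y)) Z S T F' G'"
proof -
  define P P' where "P = F \<inter> insert p X" and "P' = F' \<inter> insert p X"
  define K K' where "K = F \<inter> Y" and "K' = F' \<inter> Y"
  have FPK: "F = P \<union> K" "F' = P' \<union> K'"
    using F by (auto simp: P_def P'_def K_def K'_def)
  have KY: "K \<subseteq> Y" "K' \<subseteq> Y" "K \<subseteq> K'" using F by (auto simp: K_def K'_def)
  have "P \<subseteq> P'" "P' \<subseteq> insert p X" using F by (auto simp: P_def P'_def)
  from guts_point_profile[OF guts this] obtain H H' where H: "H \<subseteq> H'" "H' \<subseteq> X"
    and "\<forall>W \<subseteq> Y \<union> Z. conn P W = conn H W \<and> conn P' W = conn H' W"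
    by (elim exE conjE)
  then have prof: "\<And>W. W \<subseteq> Y \<union> Z \<Longrightarrow> conn P W = conn H W"
    and prof': "\<And>W. W \<subseteq> Y \<union> Z \<Longrightarrow> conn P' W = conn H' W"
    by simp_all
  have FH: "conn F W = conn (H \<union> K) W" if "W \<subseteq> Z" for W
  proof -
    have "K \<union> W \<subseteq> Y \<union> Z" "K \<subseteq> Y \<union> Z" using that KY by auto
    then show ?thesis
      unfolding FPK conn_Un_left[of P] conn_Un_left[of H] by (simp only: prof)
  qed
  have FH': "conn F' W = conn (H' \<union> K') W" if "W \<subseteq> Z" for W
  proof -
    have "K' \<union> W \<subseteq> Y \<union> Z" "K' \<subseteq> Y \<union> Z" using that KY by auto
    then show ?thesis
      unfolding FPK conn_Un_left[of P'] conn_Un_left[of H'] by (simp only: prof')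
  qed
  have "X0 \<subseteq> X" using guts by (simp add: guts_point_def)
  then have "rank indep (insert p (X \<union> Y)) = rank indep (X \<union> Y)"
    by (intro guts_point_rank_insert[OF guts]) auto
  note pXY = conn_insert_closure(1)[OF this]
  have "guts_span indep (insert p (X \<union> Y)) Z S T F G = guts_span indep (X \<union> Y) Z S T (H \<union> K) G"
    using TZ G FH by (simp add: guts_span_def pXY)
  moreover have "guts_span indep (insert p (X \<union> Y)) Z S T F' G'
      = guts_span indep (X \<union> Y) Z S T (H' \<union> K') G'"
    using TZ G FH' by (simp add: guts_span_def pXY)
  moreover have "guts_span indep (X \<union> Y) Z S T (H \<union> K) G
      \<le> guts_span indep (X \<union> Y) Z S T (H' \<union> K') G'"
    using H KY G by (intro span_mono) auto
  ultimately show ?thesis by simp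
qed

end

section \<open>Comparing matroids that agree in rank\<close>

lemma guts_span_cong:
  assumes "\<And>U. U \<subseteq> A \<union> B \<Longrightarrow> rank i1 U = rank i2 U"
    and "S \<subseteq> A" "T \<subseteq> B" "F \<subseteq> A" "G \<subseteq> B"
  shows "guts_span i1 A B S T F G = guts_span i2 A B S T F G"
proof -
  have "local_conn i1 U V = local_conn i2 U V" if "U \<subseteq> A" "V \<subseteq> B" for U V
  proof -
    have "U \<subseteq> A \<union> B" "V \<subseteq> A \<union> B" "U \<union> V \<subseteq> A \<union> B" using that by auto
    then show ?thesis by (simp add: local_conn_def assms(1))
  qed
  then show ?thesis using assms(2-5) by (simp add: guts_span_def)
qed

text \<open>\<open>rank_insert_guts\<close> expresses the rank of a set containing \<open>q\<close>
  by ranks of subsets of \<open>A \<union> B\<close>, where the two matroids agree.\<close>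

lemma guts_point_rank_unique:
  assumes "matroid E1 i1" "matroid E2 i2"
    and g1: "guts_point i1 A B S T q" and g2: "guts_point i2 A B S T q"
    and agree: "\<And>U. U \<subseteq> A \<union> B \<Longrightarrow> rank i1 U = rank i2 U"
    and U: "U \<subseteq> insert q (A \<union> B)"
  shows "rank i1 U = rank i2 U"
proof (cases "U \<subseteq> A \<union> B")
  case True
  then show ?thesis by (rule agree)
next
  case False
  define F G where "F = U \<inter> A" and "G = U \<inter> B"
  have FG: "F \<subseteq> A" "G \<subseteq> B" by (auto simp: F_def G_def)
  have Ueq: "U = insert q (F \<union> G)" using False U by (auto simp: F_def G_def)
  have ST: "S \<subseteq> A" "T \<subseteq> B" using g1 by (auto simp: guts_point_def)
  have "F \<union> G \<subseteq> A \<union> B" using FG by auto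
  then show ?thesis
    using matroid.rank_insert_guts[OF assms(1) g1 FG] matroid.rank_insert_guts[OF assms(2) g2 FG]
      guts_span_cong[OF agree ST FG] agree[of "F \<union> G"] Ueq by simp
qed

lemma circuit_cong_rank:
  assumes "matroid E1 i1" "matroid E2 i2" "C \<subseteq> E1" "C \<subseteq> E2"
    and "\<And>U. U \<subseteq> C \<Longrightarrow> rank i1 U = rank i2 U"
  shows "circuit E1 i1 C \<longleftrightarrow> circuit E2 i2 C"
proof -
  have "i1 U \<longleftrightarrow> i2 U" if "U \<subseteq> C" for U
    using assms(5)[OF that] matroid.indep_iff_rank[OF assms(1)] matroid.indep_iff_rank[OF assms(2)]
    by simp
  then show ?thesis using assms(3,4) unfolding circuit_def by auto
qed

text \<open>A strand is nonempty because its connectivity is 1, so \<open>{q}\<close> is a proper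
  subset of a circuit and has rank 1. A general \<open>P\<close> lets this serve both the one-point
  extensions and the extension by two points.\<close>

lemma guts_point_of_circuits:
  assumes sep: "exact_3_separation E indep A B"
    and strands: "strand indep A B S" "strand indep B A T"
    and ext: "extension E indep P indep'" and q: "q \<in> P"
    and circuits: "circuit E' indep' (S \<union> {q})" "circuit E' indep' (T \<union> {q})"
  shows "guts_point indep' A B S T q"
proof -
  interpret M': matroid "E \<union> P" indep' using ext by (simp add: extension_def)
  have AB: "A \<union> B = E" "local_conn indep A B = 2"
    using sep by (auto simp: exact_3_separation_def local_conn_def)
  have PE: "P \<inter> E = {}" using ext by (simp add: extension_def)
  have ST: "S \<subseteq> A" "T \<subseteq> B" "local_conn indep S B = 1" "local_conn indep T A = 1"
    using strands by (auto simp: strand_def)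
  have disj: "A \<inter> P = {}" "B \<inter> P = {}" "S \<inter> P = {}" "T \<inter> P = {}"
    using AB PE ST by auto
  note conn' = local_conn_extension[OF ext]
  have conns: "M'.conn A B = 2" "M'.conn S B = 1" "M'.conn A T = 1"
    using AB ST disj conn' M'.conn_commute[of A T] by simp_all
  have "q \<notin> S" "q \<notin> T" using disj q by auto
  moreover have "S \<noteq> {}" using conns(2) by auto
  ultimately show ?thesis
    using circuits conns ST M'.circuit_rank_remove M'.circuit_rank_singleton
    by (simp add: guts_point_def)
qed

section \<open>The extension by both points\<close>

theorem theorem1p2:
  fixes E X Y Z X0 Y0 Y1 Z1 :: "'a set" and indep :: "'a set \<Rightarrow> bool" and p q :: 'a
  assumes "matroid E indep"
    and "X \<union> Y \<union> Z = E" "X \<inter> Y = {}" "X \<inter> Z = {}" "Y \<inter> Z = {}"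
    and "exact_3_separation E indep X (Y \<union> Z)"
    and "exact_3_separation E indep (X \<union> Y) Z"
    and "p \<noteq> q"
    and "strand indep X (Y \<union> Z) X0"
    and "strand indep (Y \<union> Z) X Y0"
    and "local_conn indep X0 Y0 = 1"
    and "\<exists>indep'. extension E indep {p} indep' \<and>
           circuit (E \<union> {p}) indep' (X0 \<union> {p}) \<and> circuit (E \<union> {p}) indep' (Y0 \<union> {p})"
    and "strand indep (X \<union> Y) Z Y1"
    and "strand indep Z (X \<union> Y) Z1"
    and "local_conn indep Y1 Z1 = 1"
    and "\<exists>indep'. extension E indep {q} indep' \<and>
           circuit (E \<union> {q}) indep' (Y1 \<union> {q}) \<and> circuit (E \<union> {q}) indep' (Z1 \<union> {q})"
  shows "\<exists>!indep'. extension E indep {p, q} indep' \<and>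
           circuit (E \<union> {p, q}) indep' (X0 \<union> {p}) \<and> circuit (E \<union> {p, q}) indep' (Y0 \<union> {p}) \<and>
           circuit (E \<union> {p, q}) indep' (Y1 \<union> {q}) \<and> circuit (E \<union> {p, q}) indep' (Z1 \<union> {q})"
proof -
  note M = assms(1) and E = assms(2) and sepX = assms(6) and sepZ = assms(7)
  interpret M: matroid E indep by (rule M)
  obtain ip where p: "extension E indep {p} ip"
      "circuit (E \<union> {p}) ip (X0 \<union> {p})" "circuit (E \<union> {p}) ip (Y0 \<union> {p})"
    using assms(12) by blast
  obtain iq where q: "extension E indep {q} iq"
      "circuit (E \<union> {q}) iq (Y1 \<union> {q})" "circuit (E \<union> {q}) iq (Z1 \<union> {q})"
    using assms(16) by blast
  interpret Mp: matroid "E \<union> {p}" ip using p by (simp add: extension_def)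
  interpret Mq: matroid "E \<union> {q}" iq using q by (simp add: extension_def)
  have new: "p \<notin> E" "q \<notin> E" using p q by (auto simp: extension_def)
  note guts_p = guts_point_of_circuits[OF sepX assms(9,10)]
  note guts_q = guts_point_of_circuits[OF sepZ assms(13,14)]
  have gp: "guts_point ip X (Y \<union> Z) X0 Y0 p" using guts_p[OF p(1) _ p(2,3)] by simp
  have gq: "guts_point iq (X \<union> Y) Z Y1 Z1 q" using guts_q[OF q(1) _ q(2,3)] by simp
  have sub: "X0 \<subseteq> X" "Y0 \<subseteq> Y \<union> Z" "Y1 \<subseteq> X \<union> Y" "Z1 \<subseteq> Z"
    using assms(9,10,13,14) by (auto simp: strand_def)
  have rank_p: "rank ip U = rank indep U" if "U \<subseteq> E" for U
    using that new by (intro rank_extension[OF p(1)]) auto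
  have rank_q: "rank iq U = rank indep U" if "U \<subseteq> E" for U
    using that new by (intro rank_extension[OF q(1)]) auto
  have span_pq: "guts_span ip (X \<union> Y) Z Y1 Z1 F G = guts_span iq (X \<union> Y) Z Y1 Z1 F G"
    if "F \<subseteq> X \<union> Y" "G \<subseteq> Z" for F G
    using that sub rank_p rank_q E by (intro guts_span_cong) auto
  have pXY: "rank ip (insert p (X \<union> Y)) = rank ip (X \<union> Y)"
    using sub by (intro Mp.guts_point_rank_insert[OF gp]) auto
  have conn_pq: "Mp.conn U V = Mq.conn U V" if "U \<subseteq> E" "V \<subseteq> E" for U V
    using that rank_p rank_q by (simp add: local_conn_def)
  have conns: "Mp.conn (insert p (X \<union> Y)) Z = 2" "Mp.conn Y1 Z = 1"
      "Mp.conn (insert p (X \<union> Y)) Z1 = 1"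
    using gq sub E conn_pq[of "X \<union> Y" Z] conn_pq[of Y1 Z] conn_pq[of "X \<union> Y" Z1]
    unfolding guts_point_def Mp.conn_insert_closure(1)[OF pXY] by auto
  \<comment> \<open>Monotonicity holds in \<open>iq\<close>, where \<open>q\<close> exists, and
    passes to \<open>ip\<close> because both matroids restrict to the given one on
    \<open>E\<close>.\<close>
  have mono: "guts_span ip (X \<union> Y) Z Y1 Z1 F G \<le> guts_span ip (X \<union> Y) Z Y1 Z1 F' G'"
    if "F \<subseteq> F'" "F' \<subseteq> X \<union> Y" "G \<subseteq> G'" "G' \<subseteq> Z" for F F' G G'
    using Mq.guts_span_mono[OF gq that] that span_pq[of F G] span_pq[of F' G'] by auto
  \<comment> \<open>The point \<open>q\<close> is added to \<open>ip\<close> along the separation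
    whose left side has absorbed \<open>p\<close>.\<close>
  have "\<exists>N. extension (E \<union> {p}) ip {q} N \<and> (\<forall>F G. F \<subseteq> insert p (X \<union> Y) \<longrightarrow> G \<subseteq> Z \<longrightarrow>
    int (rank N (insert q (F \<union> G)))
      = Mp.r (F \<union> G) + 1 - guts_span ip (insert p (X \<union> Y)) Z Y1 Z1 F G)"
    using E assms(4,5,8) new sub
    by (intro Mp.guts_extension_exists conns Mp.guts_span_mono_insert[OF gp sub(4) mono]) auto
  then obtain N where N: "extension (E \<union> {p}) ip {q} N"
    and rank_N: "\<And>F G. F \<subseteq> insert p (X \<union> Y) \<Longrightarrow> G \<subseteq> Z \<Longrightarrow> int (rank N (insert q (F \<union> G)))
      = Mp.r (F \<union> G) + 1 - guts_span ip (insert p (X \<union> Y)) Z Y1 Z1 F G"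
    by blast
  have matN: "matroid (E \<union> {p, q}) N"
    using N by (simp add: extension_def insert_commute)
  have extN: "extension E indep {p, q} N"
  proof -
    have "deletion (deletion N {q}) {p} = deletion N {p, q}"
      by (auto simp: deletion_def fun_eq_iff)
    then show ?thesis
      using N p(1) matN new by (simp add: extension_def)
  qed
  have rank_Np: "rank N U = rank ip U" if "U \<subseteq> E \<union> {p}" for U
    using that new assms(8) by (intro rank_extension[OF N]) auto
  \<comment> \<open>On sets avoiding \<open>p\<close>, the rank formula that defines
    \<open>N\<close> is the one forced in \<open>iq\<close>. Thus the circuits through
    \<open>q\<close> carry over to \<open>N\<close>, as those through \<open>p\<close> do by
    \<open>rank_Np\<close>.\<close>
  have rank_Nq: "rank N U = rank iq U" if U: "U \<subseteq> E \<union> {q}" for U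
  proof (cases "q \<in> U")
    case False
    then have "U \<subseteq> E" using U by auto
    then show ?thesis using rank_Np[of U] rank_p[of U] rank_q[of U] by auto
  next
    case True
    define F G where "F = U \<inter> (X \<union> Y)" and "G = U \<inter> Z"
    have FG: "F \<subseteq> X \<union> Y" "G \<subseteq> Z" by (auto simp: F_def G_def)
    have Ueq: "U = insert q (F \<union> G)" using True U E by (auto simp: F_def G_def)
    have "F \<union> G \<subseteq> E" using FG E by auto
    then have "Mp.r (F \<union> G) = Mq.r (F \<union> G)" using rank_p rank_q by simp
    moreover have "guts_span ip (insert p (X \<union> Y)) Z Y1 Z1 F G
        = guts_span iq (X \<union> Y) Z Y1 Z1 F G"
      using span_pq[OF FG] by (simp add: guts_span_def Mp.conn_insert_closure(1)[OF pXY])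
    ultimately have "int (rank N U) = int (rank iq U)"
      using rank_N[of F G] Mq.rank_insert_guts[OF gq FG] FG Ueq by auto
    then show ?thesis by simp
  qed
  have "circuit (E \<union> {p, q}) N (S \<union> {p})"
    if "S \<subseteq> E" "circuit (E \<union> {p}) ip (S \<union> {p})" for S
    by (rule iffD2[OF circuit_cong_rank[OF matN Mp.matroid_axioms] that(2)])
      (use that(1) in \<open>auto intro!: rank_Np\<close>)
  moreover have "circuit (E \<union> {p, q}) N (S \<union> {q})"
    if "S \<subseteq> E" "circuit (E \<union> {q}) iq (S \<union> {q})" for S
    by (rule iffD2[OF circuit_cong_rank[OF matN Mq.matroid_axioms] that(2)])
      (use that(1) in \<open>auto intro!: rank_Nq\<close>)
  moreover have "X0 \<subseteq> E" "Y0 \<subseteq> E" "Y1 \<subseteq> E" "Z1 \<subseteq> E" using sub E by auto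
  ultimately have existence: "extension E indep {p, q} N \<and>
      circuit (E \<union> {p, q}) N (X0 \<union> {p}) \<and> circuit (E \<union> {p, q}) N (Y0 \<union> {p}) \<and>
      circuit (E \<union> {p, q}) N (Y1 \<union> {q}) \<and> circuit (E \<union> {p, q}) N (Z1 \<union> {q})"
    using extN p q by blast
  show ?thesis
  proof (rule ex1I[of _ N], rule existence)
    fix N'
    assume N': "extension E indep {p, q} N' \<and>
      circuit (E \<union> {p, q}) N' (X0 \<union> {p}) \<and> circuit (E \<union> {p, q}) N' (Y0 \<union> {p}) \<and>
      circuit (E \<union> {p, q}) N' (Y1 \<union> {q}) \<and> circuit (E \<union> {p, q}) N' (Z1 \<union> {q})"
    have matN': "matroid (E \<union> {p, q}) N'" using N' by (simp add: extension_def)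
    \<comment> \<open>In any candidate, \<open>p\<close> lies in the closure of
      \<open>X \<union> Y\<close>, so \<open>q\<close> remains a guts point when \<open>p\<close>
      joins the left side.\<close>
    have guts: "guts_point I X (Y \<union> Z) X0 Y0 p"
        "guts_point I (insert p (X \<union> Y)) Z Y1 Z1 q"
      if I: "extension E indep {p, q} I"
        "circuit (E \<union> {p, q}) I (X0 \<union> {p})" "circuit (E \<union> {p, q}) I (Y0 \<union> {p})"
        "circuit (E \<union> {p, q}) I (Y1 \<union> {q})" "circuit (E \<union> {p, q}) I (Z1 \<union> {q})" for I
    proof -
      interpret I: matroid "E \<union> {p, q}" I using I by (simp add: extension_def)
      show g: "guts_point I X (Y \<union> Z) X0 Y0 p" using guts_p[OF I(1) _ I(2,3)] by simp
      have "guts_point I (X \<union> Y) Z Y1 Z1 q" using guts_q[OF I(1) _ I(4,5)] by simp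
      then show "guts_point I (insert p (X \<union> Y)) Z Y1 Z1 q"
        using sub by (intro I.guts_point_insert_left I.guts_point_rank_insert[OF g]) auto
    qed
    have gN: "guts_point N X (Y \<union> Z) X0 Y0 p" "guts_point N (insert p (X \<union> Y)) Z Y1 Z1 q"
      using guts[of N] existence by auto
    have gN': "guts_point N' X (Y \<union> Z) X0 Y0 p" "guts_point N' (insert p (X \<union> Y)) Z Y1 Z1 q"
      using guts[of N'] N' by auto
    have XYZ: "X \<union> (Y \<union> Z) = E" "insert p (X \<union> Y) \<union> Z = insert p E" using E by auto
    have "rank N' U = rank N U" if "U \<subseteq> E" for U
    proof -
      have "U \<inter> {p, q} = {}" using that new by auto
      then show ?thesis using N' extN rank_extension by metis
    qed
    \<comment> \<open>Ranks are forced in stages: first on \<open>E\<close>, then with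
      \<open>p\<close> by the separation \<open>(X, Y \<union> Z)\<close>, then with
      \<open>q\<close> by the separation containing \<open>p\<close>.\<close>
    then have "rank N' U = rank N U" if "U \<subseteq> insert p E" for U
      using guts_point_rank_unique[OF matN' matN gN'(1) gN(1), unfolded XYZ] that by blast
    then have "rank N' U = rank N U" if "U \<subseteq> insert q (insert p E)" for U
      using guts_point_rank_unique[OF matN' matN gN'(2) gN(2), unfolded XYZ] that by blast
    moreover have "E \<union> {p, q} = insert q (insert p E)" by auto
    ultimately have "N' U \<longleftrightarrow> N U" if "U \<subseteq> E \<union> {p, q}" for U
      using that matroid.indep_iff_rank[OF matN] matroid.indep_iff_rank[OF matN'] by auto
    then show "N' = N"
      using matroid.indep_subset_ground[OF matN] matroid.indep_subset_ground[OF matN'] by blast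
  qed
qed

end
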